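(* For $n\ge 1$ let $D_{n,1}$ be the length of the first block in a uniformly random game with $n$ pairs of cards. Let $X$ be a standard Weibull random variable with parameter $2$, i.e. a random variable whose probability density function is $2xe^{-x^2}$ if $x>0$ and $0$ otherwise. Then, as $n\to\infty$, $$\frac{D_{n,1}}{2\sqrt n}\stackrel{d}{\longrightarrow} X,$$ where $\stackrel{d}{\longrightarrow}$ denotes convergence in distribution.
   Context: Cards and games: there are $n$ labels $1,\dots,n$, and for each label two cards, a blue copy and a red copy. A game with $n$ pairs of cards is an arrangement (permutation) of these $2n$ cards in a row, from left to right, such that for each label the blue card precedes the red card with the same label. $\mathcal{T}_n$ is the set of all such arrangements, so $|\mathcal{T}_n|=(2n)!/2^n$. A (uniformly) random game is a uniformly random element of $\mathcal{T}_n$. Blocks: the red cards partition an arrangement into $n$ disjoint blocks of consecutive cards; the $k$-th block ends with the $k$-th red card from the left. The length of a block is the number of cards it contains. Thus $D_{n,1}$ is the position, counted from the left starting at $1$, of the first red card. *)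

theory Defs
  imports "HOL-Probability.Probability" "HOL-Combinatorics.Multiset_Permutations"
begin

datatype colour = Blue | Red

type_synonym game_card = "nat \<times> colour"

definition cards :: "nat \<Rightarrow> game_card set" where
  "cards n = {1..n} \<times> {Blue, Red}"

definition precedes :: "'a \<Rightarrow> 'a \<Rightarrow> 'a list \<Rightarrow> bool" where
  "precedes a b xs \<longleftrightarrow> (\<exists>p q. p < q \<and> q < length xs \<and> xs ! p = a \<and> xs ! q = b)"

definition games :: "nat \<Rightarrow> game_card list set" where
  "games n = {g \<in> permutations_of_set (cards n). \<forall>i\<in>{1..n}. precedes (i, Blue) (i, Red) g}"

lemma finite_games: "finite (games n)"
  unfolding games_def by (rule finite_subset[of _ "permutations_of_set (cards n)"]) auto

lemma games_nonempty: "games n \<noteq> {}"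
proof -
  let ?g = "map (\<lambda>i. (i, Blue)) [1..<Suc n] @ map (\<lambda>i. (i, Red)) [1..<Suc n]"
  have "?g \<in> permutations_of_set (cards n)"
    by (auto simp: permutations_of_set_def cards_def distinct_map inj_on_def simp del: upt_Suc)
  moreover have "precedes (i, Blue) (i, Red) ?g" if "i \<in> {1..n}" for i
    unfolding precedes_def using that
    by (intro exI[of _ "i - 1"] exI[of _ "n + i - 1"]) (auto simp: nth_append simp del: upt_Suc)
  ultimately show ?thesis
    unfolding games_def by blast
qed

text \<open>The uniform distribution on games; \<^const>\<open>pmf_of_set\<close> is only meaningful on finite
  nonempty sets, as guaranteed by the two lemmas above.\<close>

definition random_game :: "nat \<Rightarrow> game_card list pmf" where
  "random_game n = pmf_of_set (games n)"

text \<open>Positions are counted from 1, in increasing order. With 0 put in front of the list of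
  positions of the red cards, its entry with index \<open>k \<ge> 1\<close> is the position of the \<open>k\<close>-th red
  card, and the \<open>k\<close>-th block consists of the cards after the \<open>(k - 1)\<close>-th up to and including
  the \<open>k\<close>-th red card. Only \<open>1 \<le> k \<le> n\<close> is meaningful.\<close>

definition red_positions :: "game_card list \<Rightarrow> nat list" where
  "red_positions g = filter (\<lambda>p. snd (g ! (p - 1)) = Red) [1..<Suc (length g)]"

definition block :: "game_card list \<Rightarrow> nat \<Rightarrow> game_card list" where
  "block g k = (let r = 0 # red_positions g in drop (r ! (k - 1)) (take (r ! k) g))"

definition block_length :: "game_card list \<Rightarrow> nat \<Rightarrow> nat" where
  "block_length g k = length (block g k)"

definition weibull2_density :: "real \<Rightarrow> real" where
  "weibull2_density x = (if x > 0 then 2 * x * exp (- (x ^ 2)) else 0)"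

end

theory Submission
  imports Defs
begin

text \<open>
  The first block is longer than \<open>k\<close> exactly when the first \<open>k\<close> cards are all blue
  (\<open>block_length_1_gt_iff\<close>), so the survival function of its length can be counted exactly.
  For a set of \<open>m\<close> cards containing both cards of \<open>p\<close> constrained labels there are
  \<open>m! / 2 ^ p\<close> arrangements (\<open>card_arrangements\<close>): swapping the two cards of a label pairs
  off the arrangements that respect its constraint with those that violate it, so each
  constraint halves the count. If the first \<open>k\<close> cards of a game are blue, they form an ordered
  choice of \<open>k\<close> labels, the red cards of these labels become unconstrained, and the remaining
  \<open>2 n - k\<close> cards form an arrangement with \<open>n - k\<close> constraints. Hence
  \<open>P(D > k) = n! / (n - k)! * (2 n - k)! / 2 ^ (n - k) * 2 ^ n / (2 n)!\<close>, and this is the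
  product of \<open>1 - i / (2 n - i)\<close> over \<open>i < k\<close> (\<open>prob_blue_start\<close>).

  By \<open>1 - a \<le> exp (- a)\<close> and \<open>exp (- a / (1 - a)) \<le> 1 - a\<close> the product lies between
  \<open>exp (- k (k - 1) / (4 (n - k)))\<close> and \<open>exp (- k (k - 1) / (4 n))\<close>. For \<open>k\<close> asymptotic
  to \<open>2 x sqrt n\<close> both exponents tend to \<open>- x ^ 2\<close> (\<open>survival_product_tendsto\<close>), and
  \<open>exp (- x ^ 2)\<close> is the survival function of the Weibull law (\<open>cdf_weibull2\<close>).
\<close>

section \<open>Counting arrangements in which blue precedes red\<close>

lemma precedes_map_inj:
  assumes "inj f"
  shows "precedes (f a) (f b) (map f xs) \<longleftrightarrow> precedes a b xs"
proof -
  have "p < q \<and> q < length (map f xs) \<and> map f xs ! p = f a \<and> map f xs ! q = f b \<longleftrightarrow>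
        p < q \<and> q < length xs \<and> xs ! p = a \<and> xs ! q = b" for p q
    using assms by (auto simp: inj_eq)
  then show ?thesis unfolding precedes_def by simp
qed

lemma precedes_flip:
  assumes "distinct xs" "a \<in> set xs" "b \<in> set xs" "a \<noteq> b"
  shows "precedes b a xs \<longleftrightarrow> \<not> precedes a b xs"
proof -
  obtain p q where pq: "p < length xs" "xs ! p = a" "q < length xs" "xs ! q = b"
    using assms by (metis in_set_conv_nth)
  have eq: "r = p" if "r < length xs" "xs ! r = a" for r
    using that pq assms(1) by (metis nth_eq_iff_index_eq)
  have eq': "r = q" if "r < length xs" "xs ! r = b" for r
    using that pq assms(1) by (metis nth_eq_iff_index_eq)
  have "precedes a b xs \<longleftrightarrow> p < q" "precedes b a xs \<longleftrightarrow> q < p"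
    unfolding precedes_def using pq eq eq' by (metis order.strict_trans)+
  moreover have "p \<noteq> q" using pq assms(4) by auto
  ultimately show ?thesis by auto
qed

lemma precedes_across_append:
  assumes "a \<in> set xs" "b \<in> set ys"
  shows "precedes a b (xs @ ys)"
proof -
  obtain p q where "p < length xs" "xs ! p = a" "q < length ys" "ys ! q = b"
    using assms by (metis in_set_conv_nth)
  then show ?thesis
    unfolding precedes_def by (intro exI[of _ p] exI[of _ "length xs + q"]) (auto simp: nth_append)
qed

lemma precedes_append_right:
  assumes "a \<notin> set xs"
  shows "precedes a b (xs @ ys) \<longleftrightarrow> precedes a b ys"
proof
  assume "precedes a b (xs @ ys)"
  then obtain p q where pq: "p < q" "q < length xs + length ys" "(xs @ ys) ! p = a" "(xs @ ys) ! q = b"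
    unfolding precedes_def by auto
  have "length xs \<le> p"
    using assms pq by (metis nth_append nth_mem not_less)
  with pq show "precedes a b ys"
    unfolding precedes_def
    by (intro exI[of _ "p - length xs"] exI[of _ "q - length xs"]) (auto simp: nth_append)
next
  assume "precedes a b ys"
  then obtain p q where "p < q" "q < length ys" "ys ! p = a" "ys ! q = b"
    unfolding precedes_def by auto
  then show "precedes a b (xs @ ys)"
    unfolding precedes_def
    by (intro exI[of _ "length xs + p"] exI[of _ "length xs + q"]) (auto simp: nth_append)
qed

text \<open>Beyond games, this covers what is left of a game once an initial run of blue cards has been
  removed: \<open>S\<close> then also contains red cards of labels outside \<open>L\<close>, which may go anywhere.\<close>

definition arrangements :: "nat set \<Rightarrow> game_card set \<Rightarrow> game_card list set" where
  "arrangements L S = {g \<in> permutations_of_set S. \<forall>i\<in>L. precedes (i, Blue) (i, Red) g}"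

lemma finite_arrangements: "finite S \<Longrightarrow> finite (arrangements L S)"
  unfolding arrangements_def by (rule finite_subset[of _ "permutations_of_set S"]) auto

text \<open>Exchanging the two cards of \<open>l\<close> is an involution on the arrangements constrained by \<open>L\<close>: it
  leaves the other labels alone and reverses the order of the cards of \<open>l\<close>. So exactly half of
  these arrangements have the blue card of \<open>l\<close> first.\<close>

lemma card_arrangements_insert:
  assumes S: "finite S" "(l, Blue) \<in> S" "(l, Red) \<in> S" and l: "l \<notin> L"
  shows "2 * card (arrangements (insert l L) S) = card (arrangements L S)"
proof -
  define \<sigma> where "\<sigma> = Transposition.transpose (l, Blue) (l, Red)"
  have inj: "inj \<sigma>" unfolding \<sigma>_def by (rule inj_transpose)
  have \<sigma>S: "\<sigma> ` S = S" unfolding \<sigma>_def using S by (auto simp: transpose_image_eq)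
  have invol: "map \<sigma> (map \<sigma> g) = g" for g
    unfolding \<sigma>_def by (simp add: o_def)
  have \<sigma>l: "\<sigma> (l, Blue) = (l, Red)" "\<sigma> (l, Red) = (l, Blue)"
    and \<sigma>i: "i \<noteq> l \<Longrightarrow> \<sigma> (i, c) = (i, c)" for i c
    unfolding \<sigma>_def by (auto simp: Transposition.transpose_def)
  let ?A = "arrangements (insert l L) S"
  let ?B = "{g \<in> arrangements L S. \<not> precedes (l, Blue) (l, Red) g}"
  have flip: "precedes (l, Red) (l, Blue) g \<longleftrightarrow> \<not> precedes (l, Blue) (l, Red) g"
    if "g \<in> permutations_of_set S" for g
    using that S by (intro precedes_flip) (auto simp: permutations_of_set_def)
  have perm: "map \<sigma> g \<in> permutations_of_set S" if "g \<in> permutations_of_set S" for g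
    using that inj \<sigma>S unfolding permutations_of_set_def
    by (auto simp: distinct_map intro: inj_on_subset)
  have keep: "precedes (i, Blue) (i, Red) (map \<sigma> g) \<longleftrightarrow> precedes (i, Blue) (i, Red) g"
    if "i \<in> L" for i g
    using precedes_map_inj[OF inj, of "(i, Blue)" "(i, Red)" g] that l \<sigma>i by metis
  have swap: "precedes (l, Red) (l, Blue) (map \<sigma> g) \<longleftrightarrow> precedes (l, Blue) (l, Red) g" for g
    using precedes_map_inj[OF inj, of "(l, Blue)" "(l, Red)" g] \<sigma>l by simp
  have "bij_betw (map \<sigma>) ?A ?B"
  proof (rule bij_betwI[where g = "map \<sigma>"])
    show "map \<sigma> \<in> ?A \<rightarrow> ?B"
    proof
      fix g assume g: "g \<in> ?A"
      then have "\<not> precedes (l, Blue) (l, Red) (map \<sigma> g)"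
        using swap[of g] flip[OF perm, of g] by (auto simp: arrangements_def)
      then show "map \<sigma> g \<in> ?B"
        using g perm keep by (auto simp: arrangements_def)
    qed
    show "map \<sigma> \<in> ?B \<rightarrow> ?A"
    proof
      fix g assume g: "g \<in> ?B"
      then have "precedes (l, Blue) (l, Red) (map \<sigma> g)"
        using swap[of "map \<sigma> g"] flip[of g] invol[of g] by (auto simp: arrangements_def)
      then show "map \<sigma> g \<in> ?A"
        using g perm keep by (auto simp: arrangements_def)
    qed
  qed (use invol in auto)
  then have "card ?A = card ?B" by (rule bij_betw_same_card)
  moreover have "card (arrangements L S) = card ?A + card ?B"
  proof -
    have "arrangements L S = ?A \<union> ?B" "?A \<inter> ?B = {}"
      by (auto simp: arrangements_def)
    then show ?thesis
      using finite_arrangements[OF S(1)] by (metis card_Un_disjoint finite_Un)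
  qed
  ultimately show ?thesis by simp
qed

lemma card_arrangements:
  assumes "finite S" "finite L" "L \<times> {Blue, Red} \<subseteq> S"
  shows "2 ^ card L * card (arrangements L S) = fact (card S)"
  using assms(2,3)
proof (induction L)
  case empty
  then show ?case using assms(1) by (simp add: arrangements_def)
next
  case (insert l L)
  have "2 * card (arrangements (insert l L) S) = card (arrangements L S)"
    using insert by (intro card_arrangements_insert assms(1)) auto
  moreover have "2 ^ card (insert l L) = (2 * 2 ^ card L :: nat)"
    using insert by simp
  moreover have "2 ^ card L * card (arrangements L S) = fact (card S)"
    using insert by simp
  ultimately show ?case by (metis mult.assoc mult.commute)
qed

section \<open>The law of the first block length\<close>

definition blue_start :: "nat \<Rightarrow> game_card list set" where
  "blue_start k = {g. \<forall>c\<in>set (take k g). snd c = Blue}"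

text \<open>A label with its blue card in the initial run satisfies its constraint automatically, since
  its red card comes later. For every other label both cards lie in the remainder, so its constraint
  concerns the remainder alone.\<close>

lemma games_blue_start_eq:
  assumes "k \<le> n"
  shows "games n \<inter> blue_start k =
    (\<lambda>(xs, ys). xs @ ys) `
      (SIGMA xs : {xs. length xs = k \<and> distinct xs \<and> set xs \<subseteq> {1..n} \<times> {Blue}}.
         arrangements ({1..n} - fst ` set xs) (cards n - set xs))" (is "?G = ?f ` ?S")
proof (intro equalityI subsetI)
  fix g assume g: "g \<in> ?G"
  let ?xs = "take k g" and ?ys = "drop k g"
  have gs: "distinct g" "set g = cards n"
    using g by (auto simp: games_def permutations_of_set_def)
  have "length g = 2 * n"
    using distinct_card[OF gs(1)] gs(2) by (simp add: cards_def card_cartesian_product)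
  then have len: "length ?xs = k" using assms by simp
  have dist: "distinct (?xs @ ?ys)"
    using gs(1) unfolding append_take_drop_id .
  have un: "set ?xs \<union> set ?ys = cards n"
    using gs(2) append_take_drop_id[of k g] set_append[of ?xs ?ys] by argo
  have sub: "set ?xs \<subseteq> {1..n} \<times> {Blue}"
  proof
    fix c assume c: "c \<in> set ?xs"
    then have "c \<in> cards n" using un by blast
    moreover have "snd c = Blue" using g c by (auto simp: blue_start_def)
    ultimately show "c \<in> {1..n} \<times> {Blue}" by (auto simp: cards_def)
  qed
  have "?ys \<in> permutations_of_set (cards n - set ?xs)"
    using dist un[symmetric] unfolding distinct_append permutations_of_set_def by blast
  moreover have "precedes (i, Blue) (i, Red) ?ys" if "i \<in> {1..n} - fst ` set ?xs" for i
  proof -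
    have "(i, Blue) \<notin> set ?xs" using that by (metis DiffD2 fst_conv imageI)
    note pr = precedes_append_right[OF this]
    have "precedes (i, Blue) (i, Red) (?xs @ ?ys)"
      using g that by (auto simp: games_def)
    then show ?thesis by (simp only: pr)
  qed
  ultimately have "(?xs, ?ys) \<in> ?S"
    using len dist sub by (simp add: arrangements_def)
  then show "g \<in> ?f ` ?S" by (rule rev_image_eqI) simp
next
  fix g assume "g \<in> ?f ` ?S"
  then obtain xs ys where g: "g = xs @ ys" and xs: "length xs = k" "distinct xs"
      "set xs \<subseteq> {1..n} \<times> {Blue}"
    and ys: "ys \<in> arrangements ({1..n} - fst ` set xs) (cards n - set xs)"
    by auto
  have yset: "set ys = cards n - set xs" "distinct ys"
    using ys by (auto simp: arrangements_def permutations_of_set_def)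
  have "g \<in> permutations_of_set (cards n)"
    using xs yset unfolding g permutations_of_set_def cards_def by auto
  moreover have "precedes (i, Blue) (i, Red) g" if "i \<in> {1..n}" for i
  proof (cases "(i, Blue) \<in> set xs")
    case True
    have "(i, Red) \<in> set ys" using that xs(3) yset by (auto simp: cards_def)
    then show ?thesis unfolding g by (rule precedes_across_append[OF True])
  next
    case False
    then have "i \<notin> fst ` set xs" using xs(3) by force
    then have "precedes (i, Blue) (i, Red) ys"
      using ys that by (auto simp: arrangements_def)
    then show ?thesis unfolding g by (simp only: precedes_append_right[OF False])
  qed
  moreover have "g \<in> blue_start k"
    using xs unfolding g blue_start_def by auto
  ultimately show "g \<in> ?G" by (simp add: games_def)
qed

text \<open>The remainder can be completed in equally many ways for every choice of the initial run;
  the first factor counts the runs and the second one the completions.\<close>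

lemma card_games_blue_start:
  assumes "k \<le> n"
  shows "real (card (games n \<inter> blue_start k)) =
           fact n / fact (n - k) * (fact (2 * n - k) / 2 ^ (n - k))"
proof -
  let ?X = "{xs. length xs = k \<and> distinct xs \<and> set xs \<subseteq> {1..n} \<times> {Blue}}"
  let ?Y = "\<lambda>xs. arrangements ({1..n} - fst ` set xs) (cards n - set xs)"
  have fin: "finite (cards n)" by (simp add: cards_def)
  have cY: "real (card (?Y xs)) = fact (2 * n - k) / 2 ^ (n - k)" if "xs \<in> ?X" for xs
  proof -
    have sub: "set xs \<subseteq> cards n" using that by (auto simp: cards_def)
    have cx: "card (set xs) = k" using that distinct_card by auto
    have "snd c = Blue" if "c \<in> set xs" for c
      using that \<open>xs \<in> ?X\<close> by auto
    then have "inj_on fst (set xs)" by (intro inj_onI prod_eqI) auto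
    then have cf: "card (fst ` set xs) = k" using cx by (simp add: card_image)
    have cL: "card ({1..n} - fst ` set xs) = n - k"
      using that cf by (subst card_Diff_subset) auto
    have cS: "card (cards n - set xs) = 2 * n - k"
      using sub cx by (subst card_Diff_subset) (auto simp: cards_def card_cartesian_product)
    have sub2: "({1..n} - fst ` set xs) \<times> {Blue, Red} \<subseteq> cards n - set xs"
      by (force simp: cards_def)
    have "2 ^ (n - k) * card (?Y xs) = fact (2 * n - k)"
      using card_arrangements[OF _ _ sub2] fin cL cS by simp
    then have "2 ^ (n - k) * real (card (?Y xs)) = fact (2 * n - k)"
      by (metis of_nat_fact of_nat_mult of_nat_numeral of_nat_power)
    then show ?thesis by (simp add: field_simps)
  qed
  have "inj_on (\<lambda>(xs, ys). xs @ ys) (SIGMA xs:?X. ?Y xs)"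
    by (auto simp: inj_on_def)
  then have "card (games n \<inter> blue_start k) = card (SIGMA xs:?X. ?Y xs)"
    by (simp add: games_blue_start_eq[OF assms] card_image)
  also have "\<dots> = (\<Sum>xs\<in>?X. card (?Y xs))"
  proof (rule card_SigmaI)
    show "finite ?X"
      by (rule finite_subset[OF _ finite_lists_length_eq[of "{1..n} \<times> {Blue}" k]]) auto
  qed (auto intro: finite_arrangements simp: fin)
  finally have "real (card (games n \<inter> blue_start k)) = real (card ?X) * (fact (2 * n - k) / 2 ^ (n - k))"
    using cY by simp
  moreover have "real (card ?X) = fact n / fact (n - k)"
  proof -
    have "card ?X = \<Prod>{n - k + 1..n}"
      using card_lists_distinct_length_eq[of "{1..n} \<times> {Blue}" k] assms
      by (simp add: card_cartesian_product)
    also have "\<dots> = fact n div fact (n - k)"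
      using fact_div_fact[of "n - k" n] by simp
    finally show ?thesis by (simp add: real_of_nat_div fact_dvd)
  qed
  ultimately show ?thesis by simp
qed

text \<open>The \<open>i\<close>-th factor (counted from 0) is the conditional probability \<open>2 (n - i) / (2 n - i)\<close>
  that the card after an initial run of \<open>i\<close> blue cards is blue again. Writing it as \<open>1 - a\<close> with
  small \<open>a\<close> prepares the comparison with the exponential function.\<close>

lemma prob_blue_start:
  assumes "k \<le> n"
  shows "measure_pmf.prob (random_game n) (blue_start k) =
           (\<Prod>i<k. 1 - real i / (2 * real n - real i))"
proof (cases "n = 0")
  case True
  then show ?thesis using assms by (simp add: blue_start_def)
next
  case False
  have "measure_pmf.prob (random_game n) (blue_start k) =
          card (games n \<inter> blue_start k) / card (games n)"
    unfolding random_game_def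
    by (rule measure_pmf_of_set[OF games_nonempty finite_games])
  \<comment> \<open>Every game starts with a run of no blue cards, so \<open>k = 0\<close> counts all games.\<close>
  also have "real (card (games n)) = fact (2 * n) / 2 ^ n"
    using card_games_blue_start[of 0 n] by (simp add: blue_start_def)
  also have "real (card (games n \<inter> blue_start k)) / (fact (2 * n) / 2 ^ n) =
      (\<Prod>i<k. 1 - real i / (2 * real n - real i))"
    unfolding card_games_blue_start[OF assms] using assms
  proof (induction k)
    case 0
    then show ?case by simp
  next
    case (Suc k)
    have k: "n - k = Suc (n - Suc k)" "2 * n - k = Suc (2 * n - Suc k)"
      using Suc.prems by auto
    have r: "real (n - k) = real n - real k" "real (2 * n - k) = 2 * real n - real k"
      using Suc.prems by (auto simp: of_nat_diff)
    have f1: "fact (n - k) = (real n - real k) * (fact (n - Suc k) :: real)"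
      using r(1) by (metis fact_Suc k(1))
    have f2: "fact (2 * n - k) = (2 * real n - real k) * (fact (2 * n - Suc k) :: real)"
      using r(2) by (metis fact_Suc k(2))
    have f3: "(2::real) ^ (n - k) = 2 * 2 ^ (n - Suc k)"
      by (subst k(1)) simp
    have nz: "real n - real k > 0" "2 * real n - real k > 0" using Suc.prems by auto
    have cancel: "N / (u * F) * (v * G / (2 * T)) / C * (2 * u / v) = N / F * (G / T) / C"
      if "u > 0" "v > 0" for N u v F G T C :: real
      using that by simp
    have "(\<Prod>i<Suc k. 1 - real i / (2 * real n - real i)) =
       (\<Prod>i<k. 1 - real i / (2 * real n - real i)) * (1 - real k / (2 * real n - real k))"
      by simp
    also have "1 - real k / (2 * real n - real k) = 2 * (real n - real k) / (2 * real n - real k)"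
      using nz by (simp add: field_simps)
    also have "(\<Prod>i<k. 1 - real i / (2 * real n - real i)) =
       fact n / fact (n - k) * (fact (2 * n - k) / 2 ^ (n - k)) / (fact (2 * n) / 2 ^ n)"
      using Suc by simp
    also have "fact n / fact (n - k) * (fact (2 * n - k) / 2 ^ (n - k)) / (fact (2 * n) / 2 ^ n) *
         (2 * (real n - real k) / (2 * real n - real k)) =
         fact n / ((real n - real k) * fact (n - Suc k)) *
           ((2 * real n - real k) * fact (2 * n - Suc k) / (2 * 2 ^ (n - Suc k))) / (fact (2 * n) / 2 ^ n) *
         (2 * (real n - real k) / (2 * real n - real k))"
      unfolding f1 f2 f3 ..
    also have "\<dots> = fact n / fact (n - Suc k) * (fact (2 * n - Suc k) / 2 ^ (n - Suc k)) /
        (fact (2 * n) / 2 ^ n)"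
      using cancel[OF nz] .
    finally show ?case by simp
  qed
  finally show ?thesis .
qed

text \<open>A red card is needed because otherwise the list of red positions is empty and the first block
  has no meaningful end.\<close>

lemma block_length_1_gt_iff:
  assumes "\<exists>c\<in>set g. snd c = Red" "k \<le> length g"
  shows "block_length g 1 > k \<longleftrightarrow> g \<in> blue_start k"
proof -
  define j where "j = length (takeWhile (\<lambda>c. snd c \<noteq> Red) g)"
  have j: "j < length g"

  proof -
    have "takeWhile (\<lambda>c. snd c \<noteq> Red) g \<noteq> g"
      using assms(1) by (simp add: takeWhile_eq_all_conv)
    then have "length (takeWhile (\<lambda>c. snd c \<noteq> Red) g) \<noteq> length g"
      using takeWhile_eq_take[of "\<lambda>c. snd c \<noteq> Red" g] by (metis take_all order_refl)
    then show ?thesis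
      using length_takeWhile_le[of "\<lambda>c. snd c \<noteq> Red" g] unfolding j_def by linarith
  qed
  have jr: "snd (g ! j) = Red"
    using nth_length_takeWhile[of "\<lambda>c. snd c \<noteq> Red" g] j unfolding j_def by auto
  have jb: "snd (g ! i) \<noteq> Red" if "i < j" for i
    using that takeWhile_nth[of i _ g] set_takeWhileD[OF nth_mem, of i] unfolding j_def by force
  have "[1..<Suc (length g)] = [1..<Suc j] @ [Suc j..<Suc (length g)]"
    using upt_add_eq_append[of 1 "Suc j" "length g - j"] j by (simp del: upt_Suc)
  also have "[Suc j..<Suc (length g)] = Suc j # [Suc (Suc j)..<Suc (length g)]"
    using j by (intro upt_conv_Cons) simp
  finally have "[1..<Suc (length g)] = [1..<Suc j] @ Suc j # [Suc (Suc j)..<Suc (length g)]" .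
  moreover have "filter (\<lambda>p. snd (g ! (p - 1)) = Red) [1..<Suc j] = []"
    using jb by (auto simp: filter_empty_conv simp del: upt_Suc)
  ultimately have "red_positions g ! 0 = Suc j"
    using jr by (simp add: red_positions_def del: upt_Suc)
  then have "block_length g 1 = Suc j"
    using j by (simp add: block_length_def block_def)
  moreover have "g \<in> blue_start k \<longleftrightarrow> k \<le> j"
  proof
    assume "g \<in> blue_start k"
    then have "snd (g ! i) = Blue" if "i < k" for i
      using that assms(2) nth_mem[of i "take k g"] unfolding blue_start_def by simp
    then show "k \<le> j" using jr by (metis colour.distinct(1) not_less)
  next
    assume "k \<le> j"
    then have "snd (g ! i) = Blue" if "i < k" for i
      using jb[of i] that by (metis colour.exhaust order_less_le_trans)
    moreover have "\<exists>i<k. c = g ! i" if "c \<in> set (take k g)" for c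
      using that by (auto simp: in_set_conv_nth)
    ultimately show "g \<in> blue_start k"
      unfolding blue_start_def by blast
  qed
  ultimately show ?thesis by auto
qed

lemma cdf_scaled_block_length:
  fixes x :: real
  assumes n: "n \<ge> 1" and x: "x \<ge> 0" and k: "k = nat \<lfloor>2 * x * sqrt n\<rfloor>" "k \<le> n"
  shows "cdf (distr (measure_pmf (random_game n)) borel
             (\<lambda>g. real (block_length g 1) / (2 * sqrt (real n)))) x =
         1 - (\<Prod>i<k. 1 - real i / (2 * real n - real i))"
proof -
  let ?D = "\<lambda>g. real (block_length g 1) / (2 * sqrt (real n))"
  have s: "sqrt n > 0" using n by simp
  have iff: "?D g \<le> x \<longleftrightarrow> g \<notin> blue_start k" if g: "g \<in> games n" for g
  proof -
    have gs: "distinct g" "set g = cards n"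
      using g by (auto simp: games_def permutations_of_set_def)
    have len: "length g = 2 * n"
      using distinct_card[OF gs(1)] gs(2) by (simp add: cards_def card_cartesian_product)
    have "(1, Red) \<in> set g" using gs n by (simp add: cards_def)
    then have red: "\<exists>c\<in>set g. snd c = Red" by force
    have "?D g \<le> x \<longleftrightarrow> real (block_length g 1) \<le> 2 * x * sqrt n"
      using s by (simp add: field_simps)
    also have "\<dots> \<longleftrightarrow> block_length g 1 \<le> k"
      unfolding k(1) using x by (simp add: le_nat_iff le_floor_iff)
    also have "\<dots> \<longleftrightarrow> g \<notin> blue_start k"
      using block_length_1_gt_iff[OF red, of k] len k(2) by auto
    finally show ?thesis .
  qed
  have "cdf (distr (measure_pmf (random_game n)) borel ?D) x
      = measure_pmf.prob (random_game n) {g. ?D g \<le> x}"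
    by (simp add: cdf_def measure_distr vimage_def)
  also have "\<dots> = measure_pmf.prob (random_game n) (- blue_start k)"
    using iff by (intro measure_pmf.finite_measure_eq_AE)
      (auto simp: AE_measure_pmf_iff random_game_def set_pmf_of_set[OF games_nonempty finite_games])
  also have "\<dots> = 1 - measure_pmf.prob (random_game n) (blue_start k)"
    using measure_pmf.prob_compl[of "blue_start k" "random_game n"] by (simp add: Compl_eq_Diff_UNIV)
  finally show ?thesis using prob_blue_start[OF k(2)] by simp
qed

section \<open>The limit of the survival probabilities\<close>

lemma exp_minus_div_le:
  fixes a :: real
  assumes "a < 1"
  shows "exp (- (a / (1 - a))) \<le> 1 - a"
proof -
  have "1 / (1 - a) = 1 + a / (1 - a)" using assms by (simp add: field_simps)
  also have "\<dots> \<le> exp (a / (1 - a))" by (rule exp_ge_add_one_self)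
  finally show ?thesis using assms by (simp add: exp_minus field_simps)
qed

lemma sum_lessThan_real: "(\<Sum>i<k. real i) = real k * (real k - 1) / 2"
  by (induction k) (auto simp: field_simps)

lemma survival_product_le:
  assumes "k \<le> n"
  shows "(\<Prod>i<k. 1 - real i / (2 * real n - real i)) \<le> exp (- (real k * (real k - 1) / (4 * real n)))"
proof -
  have "(\<Prod>i<k. 1 - real i / (2 * real n - real i)) \<le> (\<Prod>i<k. exp (- (real i / (2 * real n))))"
  proof (rule prod_mono)
    fix i assume i: "i \<in> {..<k}"
    then have "real i < real n" using assms by simp
    then have "real i / (2 * real n) \<le> real i / (2 * real n - real i)"
      "real i / (2 * real n - real i) \<le> 1"
      by (auto intro!: divide_left_mono)
    moreover have "1 + - (real i / (2 * real n)) \<le> exp (- (real i / (2 * real n)))"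
      by (rule exp_ge_add_one_self)
    ultimately show "0 \<le> 1 - real i / (2 * real n - real i) \<and>
      1 - real i / (2 * real n - real i) \<le> exp (- (real i / (2 * real n)))"
      by linarith
  qed
  also have "\<dots> = exp (- (\<Sum>i<k. real i / (2 * real n)))"
    by (simp add: exp_sum flip: sum_negf)
  also have "(\<Sum>i<k. real i / (2 * real n)) = real k * (real k - 1) / (4 * real n)"
    by (simp add: sum_lessThan_real flip: sum_divide_distrib)
  finally show ?thesis .
qed

text \<open>With \<open>a = i / (2 n - i)\<close> the quotient \<open>a / (1 - a)\<close> is \<open>i / (2 (n - i))\<close>; bounding \<open>n - i\<close>
  below by \<open>n - k\<close> makes the exponents summable in closed form.\<close>

lemma survival_product_ge:
  assumes "k < n"
  shows "exp (- (real k * (real k - 1) / (4 * (real n - real k)))) \<le>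
         (\<Prod>i<k. 1 - real i / (2 * real n - real i))"
proof -
  have total: "(\<Sum>i<k. real i / (2 * (real n - real k))) = real k * (real k - 1) / (4 * (real n - real k))"
    by (simp add: sum_lessThan_real flip: sum_divide_distrib)
  have "exp (- (real k * (real k - 1) / (4 * (real n - real k)))) =
      (\<Prod>i<k. exp (- (real i / (2 * (real n - real k)))))"
    by (simp only: exp_sum finite_lessThan flip: sum_negf total)
  also have "\<dots> \<le> (\<Prod>i<k. 1 - real i / (2 * real n - real i))"
  proof (rule prod_mono)
    fix i assume "i \<in> {..<k}"
    then have i: "real i < real k" "real k < real n" using assms by auto
    define a where "a = real i / (2 * real n - real i)"
    have "1 - a = 2 * (real n - real i) / (2 * real n - real i)"
      using i by (simp add: a_def field_simps)
    then have a: "a < 1" "a / (1 - a) = real i / (2 * (real n - real i))"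
      using i by (auto simp: a_def)
    have "real i / (2 * (real n - real i)) \<le> real i / (2 * (real n - real k))"
      using i by (intro divide_left_mono) auto
    then have "exp (- (real i / (2 * (real n - real k)))) \<le> exp (- (a / (1 - a)))"
      using a by simp
    also have "\<dots> \<le> 1 - a" by (rule exp_minus_div_le[OF a(1)])
    finally show "0 \<le> exp (- (real i / (2 * (real n - real k)))) \<and>
      exp (- (real i / (2 * (real n - real k)))) \<le> 1 - real i / (2 * real n - real i)"
      by (simp add: a_def)
  qed
  finally show ?thesis .
qed

text \<open>The limit depends on \<open>k\<close> only through its size relative to \<open>sqrt n\<close>: both bounding exponents
  are \<open>- (k / sqrt n) ^ 2 / 4\<close> up to errors that vanish in the limit.\<close>

lemma survival_product_tendsto:
  fixes k :: "nat \<Rightarrow> nat" and x :: real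
  assumes k: "(\<lambda>n. real (k n) / sqrt (real n)) \<longlonglongrightarrow> 2 * x"
    and small: "\<forall>\<^sub>F n in sequentially. k n < n"
  shows "(\<lambda>n. \<Prod>i<k n. 1 - real i / (2 * real n - real i)) \<longlonglongrightarrow> exp (- (x ^ 2))"
proof -
  \<comment> \<open>Both bounds are continuous functions of \<open>q\<close> and \<open>r\<close>: after division by \<open>n\<close>,
    \<open>k (k - 1)\<close> becomes \<open>q (q - r)\<close> and \<open>n - k\<close> becomes \<open>1 - q r\<close>.\<close>
  define q where "q = (\<lambda>n. real (k n) / sqrt (real n))"
  define r where "r = (\<lambda>n. 1 / sqrt (real n))"
  have r: "r \<longlonglongrightarrow> 0" unfolding r_def
    by (intro tendsto_divide_0[OF tendsto_const] filterlim_at_top_imp_at_infinity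
        filterlim_compose[OF sqrt_at_top filterlim_real_sequentially])
  have q: "q \<longlonglongrightarrow> 2 * x" using k by (simp add: q_def)
  have u: "(\<lambda>n. exp (- (q n * (q n - r n) / 4))) \<longlonglongrightarrow> exp (- (x ^ 2))"
    by (rule tendsto_eq_intros q r refl | simp add: power2_eq_square)+
  have l: "(\<lambda>n. exp (- (q n * (q n - r n) / (4 * (1 - q n * r n))))) \<longlonglongrightarrow> exp (- (x ^ 2))"
    by (rule tendsto_eq_intros q r refl | simp add: power2_eq_square)+
  have num: "real (k n) * (real (k n) - 1) = real n * (q n * (q n - r n))"
    and den: "real n - real (k n) = real n * (1 - q n * r n)" if "n > 0" for n
    using that by (auto simp: q_def r_def field_simps)
  have pos: "\<forall>\<^sub>F n in sequentially. n > (0::nat)" by (rule eventually_gt_at_top)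
  show ?thesis
  proof (rule tendsto_sandwich[OF _ _ l u])
    show "\<forall>\<^sub>F n in sequentially. exp (- (q n * (q n - r n) / (4 * (1 - q n * r n)))) \<le>
        (\<Prod>i<k n. 1 - real i / (2 * real n - real i))"
      using small pos
    proof eventually_elim
      case (elim n)
      have "real (k n) * (real (k n) - 1) / (4 * (real n - real (k n)))
         = q n * (q n - r n) / (4 * (1 - q n * r n))"
        unfolding num[OF elim(2)] den[OF elim(2)] using elim(2) by simp
      then show ?case using survival_product_ge[OF elim(1)] by metis
    qed
    show "\<forall>\<^sub>F n in sequentially. (\<Prod>i<k n. 1 - real i / (2 * real n - real i)) \<le>
        exp (- (q n * (q n - r n) / 4))"
      using small pos
    proof eventually_elim
      case (elim n)
      have "real (k n) * (real (k n) - 1) / (4 * real n) = q n * (q n - r n) / 4"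
        unfolding num[OF elim(2)] using elim(2) by simp
      then show ?case using survival_product_le[of "k n" n] elim(1) by (metis less_imp_le)
    qed
  qed
qed

lemma nat_floor_sqrt_asymptotics:
  fixes x :: real
  assumes "x \<ge> 0"
  defines "k \<equiv> (\<lambda>n::nat. nat \<lfloor>2 * x * sqrt (real n)\<rfloor>)"
  shows "(\<lambda>n. real (k n) / sqrt (real n)) \<longlonglongrightarrow> 2 * x"
    and "\<forall>\<^sub>F n in sequentially. k n < n"
proof -
  have k: "real (k n) \<le> 2 * x * sqrt n" "2 * x * sqrt n - 1 \<le> real (k n)" for n
    unfolding k_def using assms(1) by (auto simp: of_nat_floor)
  have r: "(\<lambda>n. 1 / sqrt (real n)) \<longlonglongrightarrow> 0"
    by (intro tendsto_divide_0[OF tendsto_const] filterlim_at_top_imp_at_infinity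
        filterlim_compose[OF sqrt_at_top filterlim_real_sequentially])
  have l: "(\<lambda>n. 2 * x - 1 / sqrt (real n)) \<longlonglongrightarrow> 2 * x"
    using tendsto_diff[OF tendsto_const r, of "2 * x"] by simp
  have pos: "\<forall>\<^sub>F n in sequentially. n > (0::nat)" by (rule eventually_gt_at_top)
  show "(\<lambda>n. real (k n) / sqrt (real n)) \<longlonglongrightarrow> 2 * x"
  proof (rule tendsto_sandwich[OF _ _ l tendsto_const])
    show "\<forall>\<^sub>F n in sequentially. 2 * x - 1 / sqrt (real n) \<le> real (k n) / sqrt (real n)"
      using pos
    proof eventually_elim
      case (elim n)
      have "2 * x - 1 / sqrt n = (2 * x * sqrt n - 1) / sqrt n"
        using elim by (simp add: diff_divide_distrib)
      then show ?case using k(2)[of n] by (simp add: divide_right_mono)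
    qed
    show "\<forall>\<^sub>F n in sequentially. real (k n) / sqrt (real n) \<le> 2 * x"
      using pos by eventually_elim (use k in \<open>auto simp: field_simps\<close>)
  qed
  have "\<forall>\<^sub>F n in sequentially. 2 * x < sqrt (real n)"
    using filterlim_compose[OF sqrt_at_top filterlim_real_sequentially]
    by (auto simp: filterlim_at_top_dense)
  then show "\<forall>\<^sub>F n in sequentially. k n < n"
    using pos
  proof eventually_elim
    case (elim n)
    have "2 * x * sqrt n < sqrt n * sqrt n"
      using elim by (intro mult_strict_right_mono) auto
    also have "\<dots> = real n" by simp
    finally show ?case using k(1)[of n] by linarith
  qed
qed

section \<open>The Weibull distribution function and convergence\<close>

lemma cdf_weibull2:
  assumes X: "distributed M lborel X (\<lambda>x. ennreal (weibull2_density x))"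
  shows "cdf (distr M borel X) x = (if x \<le> 0 then 0 else 1 - exp (- (x ^ 2)))"
proof -
  have mX: "X \<in> borel_measurable M"
    using distributed_measurable[OF X] by simp
  have "emeasure (distr M borel X) {..x} = emeasure M (X -` {..x} \<inter> space M)"
    using mX by (simp add: emeasure_distr)
  also have "\<dots> = (\<integral>\<^sup>+ t. ennreal (weibull2_density t) * indicator {..x} t \<partial>lborel)"
    by (rule distributed_emeasure[OF X]) simp
  also have "\<dots> = ennreal (if x \<le> 0 then 0 else 1 - exp (- (x ^ 2)))"
  proof (cases "x \<le> 0")
    case True
    have "ennreal (weibull2_density t) * indicator {..x} t = 0" for t
      using True by (auto simp: weibull2_density_def indicator_def)
    then show ?thesis using True by (simp only: nn_integral_const) simp
  next
    case False
    have "(\<integral>\<^sup>+ t. ennreal (weibull2_density t) * indicator {..x} t \<partial>lborel) =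
          (\<integral>\<^sup>+ t. ennreal (2 * t * exp (- (t ^ 2))) * indicator {0..x} t \<partial>lborel)"
      by (intro nn_integral_cong) (auto simp: weibull2_density_def indicator_def)
    also have "\<dots> = (- exp (- (x ^ 2))) - (- exp (- (0 ^ 2)))"
      using False
      by (intro nn_integral_FTC_Icc) (auto intro!: derivative_eq_intros)
    finally show ?thesis using False by simp
  qed
  finally show ?thesis
    by (auto simp: cdf_def measure_def)
qed

text \<open>The limiting distribution function is continuous, so convergence is shown at every point.
  The length is not negative, which settles negative arguments, and \<open>x = 0\<close> is covered by the empty
  product.\<close>

theorem theorem4:
  fixes M :: "'a measure" and X :: "'a \<Rightarrow> real"
  assumes "prob_space M"
    and "distributed M lborel X (\<lambda>x. ennreal (weibull2_density x))"
  shows "weak_conv_m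
           (\<lambda>n. distr (measure_pmf (random_game n)) borel
                  (\<lambda>g. real (block_length g 1) / (2 * sqrt (real n))))
           (distr M borel X)"
  unfolding weak_conv_m_def weak_conv_def
proof (intro allI impI)
  fix x :: real
  let ?F = "\<lambda>n. cdf (distr (measure_pmf (random_game n)) borel
                  (\<lambda>g. real (block_length g 1) / (2 * sqrt (real n)))) x"
  show "?F \<longlonglongrightarrow> cdf (distr M borel X) x"
  proof (cases "x < 0")
    case True
    have "?F n = 0" for n
    proof -
      have "\<not> real (block_length g 1) / (2 * sqrt (real n)) \<le> x" for g
        using True by (smt (verit) divide_nonneg_nonneg of_nat_0_le_iff real_sqrt_ge_zero)
      then have "{g. real (block_length g 1) / (2 * sqrt (real n)) \<le> x} = {}" by blast
      then show ?thesis by (simp add: cdf_def measure_distr vimage_def)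
    qed
    then show ?thesis using True by (simp add: cdf_weibull2[OF assms(2)])
  next
    case False
    define k where "k = (\<lambda>n::nat. nat \<lfloor>2 * x * sqrt (real n)\<rfloor>)"
    have x: "x \<ge> 0" using False by simp
    have k: "(\<lambda>n. real (k n) / sqrt (real n)) \<longlonglongrightarrow> 2 * x" "\<forall>\<^sub>F n in sequentially. k n < n"
      using nat_floor_sqrt_asymptotics[OF x] by (simp_all add: k_def)
    have ev: "\<forall>\<^sub>F n in sequentially. 1 - (\<Prod>i<k n. 1 - real i / (2 * real n - real i)) = ?F n"
      using k(2) eventually_ge_at_top[of 1]
      by eventually_elim (subst cdf_scaled_block_length[OF _ x, where k = "k _"], auto simp: k_def)
    have "(\<lambda>n. 1 - (\<Prod>i<k n. 1 - real i / (2 * real n - real i))) \<longlonglongrightarrow> 1 - exp (- (x ^ 2))"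
      by (intro tendsto_diff tendsto_const survival_product_tendsto[OF k])
    then have "?F \<longlonglongrightarrow> 1 - exp (- (x ^ 2))"
      using tendsto_cong[OF ev] by blast
    then show ?thesis using x by (auto simp: cdf_weibull2[OF assms(2)])
  qed
qed

end
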